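(* Let $C,A_1,\dots,A_m\in\mathbb{S}^n$, $b\in\mathbb{R}^m$, and let $K\subseteq\mathbb{S}^n$ be a convex cone such that $Q_{n,k}\subseteq K\subseteq\mathcal{S}_{n,k}$. Consider the sparse QCQP $$(P)\quad\min_{x\in\mathbb{R}^n}x^TCx\quad\text{s.t. }\|x\|_0\le k,\ x^TA_ix=b_i,\ i\in[m],$$ and its relaxation $$(Q_K)\quad\min_{X\in\mathbb{S}^n}C\bullet X\quad\text{s.t. }A_i\bullet X=b_i,\ i\in[m],\ X\in K.$$ If $xx^T$ (with $x\in\mathbb{R}^n$) is optimal for $(Q_K)$, then the relaxation is exact and $x$ is optimal for $(P)$.
   Context: $\mathbb{S}^n$ is the space of real symmetric $n\times n$ matrices, $A\bullet B=\operatorname{Tr}(B^TA)$, $A\succeq B$ means $A-B$ is positive semidefinite, $\operatorname{diag}(X)$ is the diagonal matrix with the same diagonal as $X$, $\|x\|_0$ is the number of nonzero entries of $x$. $\mathcal{S}_{n,k}=\{X\in\mathbb{S}^n: k\operatorname{diag}(X)\succeq X\succeq 0\}$ and $Q_{n,k}=\{xx^T:x\in\mathbb{R}^n,\|x\|_0\le k\}$. Here "exact" means that the optimal solution ($xx^T$) of $(Q_K)$ lies in $Q_{n,k}$, so that $(Q_K)$ and $(P)$ have the same optimal value. *)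

theory Defs
  imports "HOL-Analysis.Analysis"
begin

definition sym_mats :: "(real^'n^'n) set" where
  "sym_mats = {X. transpose X = X}"

definition psd :: "real^'n^'n \<Rightarrow> bool" where
  "psd X \<longleftrightarrow> X \<in> sym_mats \<and> (\<forall>v. v \<bullet> (X *v v) \<ge> 0)"

definition loewner_ge :: "real^'n^'n \<Rightarrow> real^'n^'n \<Rightarrow> bool" (infix "\<succeq>\<^sub>L" 50) where
  "A \<succeq>\<^sub>L B \<longleftrightarrow> psd (A - B)"

definition mat_inner :: "real^'n^'n \<Rightarrow> real^'n^'n \<Rightarrow> real" where
  "mat_inner A B = trace (transpose B ** A)"

definition diag_part :: "real^'n^'n \<Rightarrow> real^'n^'n" where
  "diag_part X = (\<chi> i j. if i = j then X $ i $ j else 0)"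

definition l0_norm :: "real^'n \<Rightarrow> nat" where
  "l0_norm x = card {i. x $ i \<noteq> 0}"

definition outer_square :: "real^'n \<Rightarrow> real^'n^'n" where
  "outer_square x = (\<chi> i j. x $ i * x $ j)"

definition S_set :: "nat \<Rightarrow> (real^'n^'n) set" where
  "S_set k = {X \<in> sym_mats. real k *\<^sub>R diag_part X \<succeq>\<^sub>L X \<and> X \<succeq>\<^sub>L 0}"

definition Q_set :: "nat \<Rightarrow> (real^'n^'n) set" where
  "Q_set k = {outer_square x | x. l0_norm x \<le> k}"

definition quad_form :: "real^'n^'n \<Rightarrow> real^'n \<Rightarrow> real" where
  "quad_form A x = x \<bullet> (A *v x)"

text \<open>The constraint data are indexed by \<open>{1..m}\<close>, with \<open>m = 0\<close> allowed; values of
  \<open>A\<close> and \<open>b\<close> outside this range are irrelevant.\<close>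

definition P_feasible ::
    "nat \<Rightarrow> nat \<Rightarrow> (nat \<Rightarrow> real^'n^'n) \<Rightarrow> (nat \<Rightarrow> real) \<Rightarrow> (real^'n) set" where
  "P_feasible k m A b = {x. l0_norm x \<le> k \<and> (\<forall>i\<in>{1..m}. quad_form (A i) x = b i)}"

definition QK_feasible ::
    "(real^'n^'n) set \<Rightarrow> nat \<Rightarrow> (nat \<Rightarrow> real^'n^'n) \<Rightarrow> (nat \<Rightarrow> real) \<Rightarrow> (real^'n^'n) set" where
  "QK_feasible K m A b =
     {X \<in> sym_mats. (\<forall>i\<in>{1..m}. mat_inner (A i) X = b i) \<and> X \<in> K}"

text \<open>Optimal solutions are attained minimizers.  The optimal value is taken in the extended
  reals, so it is \<open>\<infinity>\<close> for an infeasible problem and \<open>-\<infinity>\<close> for an unbounded one.\<close>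

definition optimal_for :: "('a \<Rightarrow> real) \<Rightarrow> 'a set \<Rightarrow> 'a \<Rightarrow> bool" where
  "optimal_for f F x \<longleftrightarrow> is_arg_min f (\<lambda>y. y \<in> F) x"

definition opt_value :: "('a \<Rightarrow> real) \<Rightarrow> 'a set \<Rightarrow> ereal" where
  "opt_value f F = (INF x\<in>F. ereal (f x))"

end

theory Submission
  imports Defs
begin

text \<open>A rank-one matrix \<open>x x\<^sup>T\<close> in \<open>\<S>\<^bsub>n,k\<^esub>\<close> has a \<open>k\<close>-sparse \<open>x\<close>: test
  \<open>k diag(x x\<^sup>T) - x x\<^sup>T\<close> against the entrywise inverse of \<open>x\<close> on its support, of size \<open>s\<close>,
  to get \<open>k s \<ge> s\<^sup>2\<close>. Hence \<open>x\<close> is feasible for \<open>(P)\<close>, and since \<open>(Q\<^sub>K)\<close> relaxes \<open>(P)\<close> it is optimal.\<close>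

text \<open>Dictionary between the two problems: at a rank-one point the linear objective and
  constraints of the relaxation become the quadratic ones. Swapping the sums absorbs the transpose,
  so \<open>M\<close> may be arbitrary.\<close>

lemma mat_inner_outer_square: "mat_inner M (outer_square x) = quad_form M x"
proof -
  have "mat_inner M (outer_square x) = (\<Sum>i\<in>UNIV. \<Sum>j\<in>UNIV. x $ j * x $ i * M $ j $ i)"
    by (simp add: mat_inner_def outer_square_def trace_def transpose_def matrix_matrix_mult_def)
  also have "\<dots> = (\<Sum>j\<in>UNIV. \<Sum>i\<in>UNIV. x $ j * x $ i * M $ j $ i)"
    by (rule sum.swap)
  also have "\<dots> = quad_form M x"
    by (simp add: quad_form_def inner_vec_def matrix_vector_mult_def sum_distrib_left ac_simps)
  finally show ?thesis .
qed

lemma quad_form_outer_square: "quad_form (outer_square x) v = (x \<bullet> v)\<^sup>2"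
  by (simp add: quad_form_def inner_vec_def matrix_vector_mult_def outer_square_def
      power2_eq_square sum_product sum_distrib_left ac_simps)

lemma quad_form_diag_part: "quad_form (diag_part X) v = (\<Sum>i\<in>UNIV. X $ i $ i * (v $ i)\<^sup>2)"
  by (simp add: quad_form_def inner_vec_def matrix_vector_mult_def diag_part_def
      power2_eq_square if_distrib[of "\<lambda>c. c * _"] cong: if_cong)
    (simp add: ac_simps)

lemma l0_norm_le_if_outer_square_in_S_set:
  fixes x :: "real^'n"
  assumes "outer_square x \<in> S_set k"
  shows "l0_norm x \<le> k"
proof -
  define s where "s = l0_norm x"
  \<comment> \<open>Since \<open>inverse 0 = 0\<close>, \<open>v\<close> vanishes off the support of
    \<open>x\<close>, and each product \<open>x $ i * v $ i\<close> is 1 on it and 0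
    elsewhere.\<close>
  define v :: "real^'n" where "v = (\<chi> i. inverse (x $ i))"
  have support_sum: "(\<Sum>i\<in>UNIV. if x $ i = 0 then 0 else 1) = real s"
    by (simp add: s_def l0_norm_def sum.If_cases Compl_eq)
  have xv: "x \<bullet> v = real s"
    unfolding support_sum[symmetric]
    by (auto simp: inner_vec_def v_def intro!: sum.cong)
  have dv: "quad_form (diag_part (outer_square x)) v = real s"
    unfolding support_sum[symmetric]
    by (auto simp: quad_form_diag_part outer_square_def v_def power2_eq_square field_simps intro!: sum.cong)
  have "0 \<le> quad_form (real k *\<^sub>R diag_part (outer_square x) - outer_square x) v"
    using assms by (simp add: S_set_def loewner_ge_def psd_def quad_form_def)
  also have "\<dots> = real k * quad_form (diag_part (outer_square x)) v - quad_form (outer_square x) v"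
    by (simp add: quad_form_def matrix_vector_mult_diff_rdistrib inner_diff_right
        scaleR_matrix_vector_assoc[symmetric])
  finally have "real s * real s \<le> real k * real s"
    by (simp add: dv quad_form_outer_square xv power2_eq_square)
  then have "s * s \<le> k * s"
    by (metis of_nat_le_iff of_nat_mult)
  \<comment> \<open>Cancelling \<open>s\<close> needs \<open>s > 0\<close>; for \<open>s = 0\<close>
    the bound is trivial.\<close>
  then show ?thesis
    by (cases "s = 0") (simp_all add: s_def)
qed

text \<open>An attained minimum is a lower bound that belongs to the set of values. Applied to both
  problems, this reduces equality of the optimal values to equality of the objectives at the two
  minimizers.\<close>

lemma opt_value_eq_if_optimal_for:
  assumes "optimal_for f F x"
  shows "opt_value f F = ereal (f x)"
  unfolding opt_value_def
proof (rule antisym)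
  show "(INF y\<in>F. ereal (f y)) \<le> ereal (f x)"
    using assms by (intro INF_lower) (simp add: optimal_for_def is_arg_min_def)
  show "ereal (f x) \<le> (INF y\<in>F. ereal (f y))"
    using assms by (intro INF_greatest) (auto simp: optimal_for_def is_arg_min_def not_less)
qed

theorem lemma2p4:
  fixes C :: "real^'n^'n"
    and A :: "nat \<Rightarrow> real^'n^'n"
    and b :: "nat \<Rightarrow> real"
    and m k :: nat
    and K :: "(real^'n^'n) set"
    and x :: "real^'n"
  assumes "C \<in> sym_mats"
    and "\<forall>i\<in>{1..m}. A i \<in> sym_mats"
    and "K \<subseteq> sym_mats"
    and "convex_cone K"
    and "Q_set k \<subseteq> K"
    and "K \<subseteq> S_set k"
    and "optimal_for (mat_inner C) (QK_feasible K m A b) (outer_square x)"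
  shows "outer_square x \<in> Q_set k
    \<and> opt_value (mat_inner C) (QK_feasible K m A b) = opt_value (quad_form C) (P_feasible k m A b)
    \<and> optimal_for (quad_form C) (P_feasible k m A b) x"
proof -
  have feasible: "outer_square x \<in> QK_feasible K m A b"
    and minimal: "\<And>Y. Y \<in> QK_feasible K m A b \<Longrightarrow> mat_inner C (outer_square x) \<le> mat_inner C Y"
    using assms(7) by (auto simp: optimal_for_def is_arg_min_def not_less)
  have sparse: "l0_norm x \<le> k"
    using feasible assms(6) by (auto simp: QK_feasible_def intro: l0_norm_le_if_outer_square_in_S_set)
  have relaxation: "outer_square y \<in> QK_feasible K m A b" if "y \<in> P_feasible k m A b" for y
  proof -
    have "outer_square y \<in> K"
      using that assms(5) by (auto simp: P_feasible_def Q_set_def)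
    \<comment> \<open>Symmetry of \<open>outer_square y\<close> is read off from its membership in
      \<open>K\<close>.\<close>
    then show ?thesis
      using that assms(3) by (auto simp: QK_feasible_def P_feasible_def mat_inner_outer_square)
  qed
  have "x \<in> P_feasible k m A b"
    using feasible sparse by (simp add: QK_feasible_def P_feasible_def mat_inner_outer_square)
  \<comment> \<open>Minimality over the relaxation is only tested against the rank-one competitors
    \<open>outer_square y\<close>.\<close>
  moreover have "quad_form C x \<le> quad_form C y" if "y \<in> P_feasible k m A b" for y
    using minimal[OF relaxation[OF that]] by (simp add: mat_inner_outer_square)
  ultimately have optimal: "optimal_for (quad_form C) (P_feasible k m A b) x"
    by (auto simp: optimal_for_def is_arg_min_def not_less)
  moreover have "outer_square x \<in> Q_set k"
    using sparse by (auto simp: Q_set_def)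
  ultimately show ?thesis
    by (simp add: opt_value_eq_if_optimal_for[OF assms(7)] opt_value_eq_if_optimal_for[OF optimal]
        mat_inner_outer_square)
qed

end
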